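(* Let $a\ge b>0$ be real numbers and $0<p\le 1$. Then $$\frac{p(a-b)(a^{1-p}-b^{1-p})}{2a^{1-p}}\le d_p(a,b)\le \frac{p(a-b)(a^{1-p}-b^{1-p})}{a^{1-p}}.$$
   Context: For real $a,b>0$ and $0\le p\le 1$, $d_p(a,b):=pa+(1-p)b-a^pb^{1-p}$. *)

theory Defs
  imports Complex_Main
begin

(* Only meaningful for a, b > 0 and 0 <= p <= 1: the mathematical definition is restricted
   to this range, where powr is the usual real power. *)
definition d :: "real \<Rightarrow> real \<Rightarrow> real \<Rightarrow> real" where
  "d p a b = p * a + (1 - p) * b - a powr p * b powr (1 - p)"

end

theory Submission
  imports Defs "HOL-Analysis.Convex"
begin

text \<open>
  Both sides are homogeneous of degree one in \<open>(a, b)\<close>, so with \<open>x = a / b \<ge> 1\<close> it suffices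
  to treat the pair \<open>(x, 1)\<close>. There
  \[ d_p(x, 1) = \int_1^x f(t)\,dt, \qquad f(t) = p\,(1 - t^{p-1}), \]
  and \<open>f\<close> is nondecreasing and concave on \<open>[1, x]\<close> with \<open>f 1 = 0\<close>. The upper bound
  \<open>(x - 1) f x\<close> is the area of the rectangle that encloses the region under the graph, and the
  lower bound \<open>(x - 1) f x / 2\<close> is the area of the triangle under the chord from \<open>(1, 0)\<close> to
  \<open>(x, f x)\<close>, which concavity places below the graph.

  The rectangle bound comes from the mean value theorem
  (\<open>d_le_rectangle\<close>). For the triangle bound (\<open>triangle_le_d\<close>) the difference of the two sides is
  shown to be nondecreasing in \<open>x\<close>; the sign of its derivative says that the tangent of \<open>f\<close> at
  \<open>t\<close> lies above the point \<open>(1, 0)\<close>, which is Bernoulli's inequality with exponent \<open>2 - p\<close>.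
\<close>

text \<open>Young's inequality for the numbers \<open>x powr r\<close> and \<open>1\<close> with weights \<open>1 / r\<close> and
  \<open>1 - 1 / r\<close>, multiplied by \<open>r\<close>.\<close>

lemma Bernoulli_powr:
  fixes x r :: real
  assumes "x > 0" and "r \<ge> 1"
  shows "1 + r * (x - 1) \<le> x powr r"
proof -
  have "(x powr r) powr (1 / r) * 1 powr (1 - 1 / r) \<le> 1 / r * x powr r + (1 - 1 / r) * 1"
    using assms by (intro Youngs_inequality_0) auto
  then have "x \<le> 1 / r * x powr r + (1 - 1 / r)"
    using assms by (simp add: powr_powr)
  then have "r * x \<le> r * (1 / r * x powr r + (1 - 1 / r))"
    using assms by (intro mult_left_mono) auto
  then show ?thesis
    using assms by (simp add: algebra_simps)
qed

lemma d_le_rectangle: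
  fixes x p :: real
  assumes x: "x \<ge> 1" and p: "0 < p" "p \<le> 1"
  shows "d p x 1 \<le> p * (x - 1) * (1 - x powr (p - 1))"
proof (cases "x = 1")
  case True
  then show ?thesis by (simp add: d_def)
next
  case False
  have "((\<lambda>t. d p t 1) has_real_derivative p * (1 - t powr (p - 1))) (at t)" if "1 \<le> t" for t
    unfolding d_def using that by (auto intro!: derivative_eq_intros simp: algebra_simps)
  then obtain t where t: "1 < t" "t < x"
    and eq: "d p x 1 - d p 1 1 = (x - 1) * (p * (1 - t powr (p - 1)))"
    using MVT2[of 1 x "\<lambda>t. d p t 1" "\<lambda>t. p * (1 - t powr (p - 1))"] x False by force
  have "x powr (p - 1) \<le> t powr (p - 1)"
    using t p by (intro powr_mono2') auto
  then have "(x - 1) * (p * (1 - t powr (p - 1))) \<le> (x - 1) * (p * (1 - x powr (p - 1)))"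
    using x p by (intro mult_left_mono) auto
  then show ?thesis
    using eq by (simp add: d_def mult_ac)
qed

lemma triangle_le_d:
  fixes x p :: real
  assumes x: "x \<ge> 1" and p: "0 < p" "p \<le> 1"
  shows "p * (x - 1) * (1 - x powr (p - 1)) / 2 \<le> d p x 1"
proof -
  define h where "h t = d p t 1 - p * (t - 1) * (1 - t powr (p - 1)) / 2" for t
  have "h 1 \<le> h x"
  proof (rule DERIV_nonneg_imp_nondecreasing[OF x])
    fix t :: real
    assume "1 \<le> t" "t \<le> x"
    then have t: "t > 0" by simp
    \<comment> \<open>With \<open>f s = p * (1 - s powr (p - 1))\<close> this is \<open>(f t - (t - 1) * f' t) / 2\<close>: half the
      height at \<open>1\<close> of the tangent of \<open>f\<close> at \<open>t\<close>.\<close>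
    let ?h' = "p / 2 * (1 - t powr (p - 1) - (t - 1) * (1 - p) * t powr (p - 2))"
    have "(h has_real_derivative ?h') (at t)"
      unfolding h_def d_def using t
      by (auto intro!: derivative_eq_intros simp: field_simps)
    moreover have "?h' \<ge> 0"
    proof -
      have "t powr (p - 2) * (1 + (2 - p) * (t - 1)) \<le> t powr (p - 2) * t powr (2 - p)"
        using Bernoulli_powr[OF t, of "2 - p"] p by (intro mult_left_mono) auto
      also have "\<dots> = 1"
        using t by (simp flip: powr_add)
      finally have "t powr (p - 2) * (1 + (2 - p) * (t - 1)) \<le> 1" .
      moreover have "t powr (p - 1) = t * t powr (p - 2)"
        using t powr_add[of t 1 "p - 2"] by simp
      ultimately show ?thesis
        using p by (intro mult_nonneg_nonneg) (auto simp: algebra_simps)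
    qed
    ultimately show "\<exists>y. (h has_real_derivative y) (at t) \<and> 0 \<le> y"
      by blast
  qed
  then show ?thesis
    by (simp add: h_def d_def)
qed

lemma d_homogeneous:
  fixes a b p :: real
  assumes "a > 0" and "b > 0"
  shows "d p a b = b * d p (a / b) 1"
proof -
  have "b * (a / b) powr p = a powr p * (b powr 1 * b powr (- p))"
    using assms by (simp add: powr_divide powr_minus field_simps)
  also have "b powr 1 * b powr (- p) = b powr (1 - p)"
    using powr_add[of b 1 "- p"] by simp
  finally show ?thesis
    using assms by (simp add: d_def algebra_simps)
qed

theorem theorem2p2:
  fixes a b p :: real
  assumes "a \<ge> b" and "b > 0" and "0 < p" and "p \<le> 1"
  shows "p * (a - b) * (a powr (1 - p) - b powr (1 - p)) / (2 * a powr (1 - p)) \<le> d p a b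
    \<and> d p a b \<le> p * (a - b) * (a powr (1 - p) - b powr (1 - p)) / (a powr (1 - p))"
proof -
  define x where "x = a / b"
  have a: "a > 0" and x: "x \<ge> 1"
    using assms by (auto simp: x_def)
  have "x powr (p - 1) = inverse (x powr (1 - p))"
    by (simp flip: powr_minus)
  then have "1 - x powr (p - 1) = (a powr (1 - p) - b powr (1 - p)) / a powr (1 - p)"
    using a assms by (simp add: x_def powr_divide diff_divide_distrib)
  moreover have "a - b = b * (x - 1)"
    using assms by (simp add: x_def algebra_simps)
  ultimately have rectangle: "p * (a - b) * (a powr (1 - p) - b powr (1 - p)) / a powr (1 - p)
      = b * (p * (x - 1) * (1 - x powr (p - 1)))"
    by simp
  have "d p a b = b * d p x 1"
    using d_homogeneous[OF a] assms by (simp add: x_def)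
  moreover have "b * (p * (x - 1) * (1 - x powr (p - 1)) / 2) \<le> b * d p x 1"
    using triangle_le_d[OF x] assms by (intro mult_left_mono) auto
  moreover have "b * d p x 1 \<le> b * (p * (x - 1) * (1 - x powr (p - 1)))"
    using d_le_rectangle[OF x] assms by (intro mult_left_mono) auto
  moreover have "p * (a - b) * (a powr (1 - p) - b powr (1 - p)) / (2 * a powr (1 - p))
      = b * (p * (x - 1) * (1 - x powr (p - 1)) / 2)"
    using arg_cong[OF rectangle, of "\<lambda>y. y / 2"] by (simp add: mult_ac)
  ultimately show ?thesis
    using rectangle by metis
qed

end
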